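(* Let $T_0 \in \mathcal{G}(X)$ be antiperiodic and rigid. Then $\mathcal{S}_{T_0}$ is a first category subset of $\mathcal{G}_{T_0}$.
   Context: Let $(X,m)$ and $(Y,\nu)$ both be the unit interval with Lebesgue measure, and $(Z,\mu) = (X\times Y, m\times\nu)$. $\mathcal{G}(W)$ denotes the set of invertible measure-preserving transformations of a space $W$, with the weak topology ($T_n \to T$ iff $\mu(T_nE \triangle TE) \to 0$ for every measurable $E$). $T_0$ is antiperiodic if its set of periodic points has measure zero, and rigid if there is a subsequence $n_k$ with $T_0^{n_k}\to\mathrm{id}_X$ strongly as Koopman operators on $L^2(X)$. $\mathcal{G}_{T_0} \subset \mathcal{G}(Z)$ is the set of transformations of the form $T(x,y) = (T_0x, T_x y)$ with $T_x \in \mathcal{G}(Y)$ (extensions of $T_0$), with the relative weak topology; $T_0$ is identified with $T_0\times\mathrm{id}_Y$. $\mathbb{E}(\cdot|X)$ is conditional expectation onto the $\sigma$-algebra of sets $B\times Y$. $L^2(Z|X)$ is the space of $f\in L^2(Z)$ with $\mathbb{E}(|f|^2|X)^{1/2} \in L^\infty(X)$. $T\in\mathcal{G}_{T_0}$ is a strongly mixing extension of $T_0$ if for all $f,g\in L^2(Z|X)$, $\lim_{n\to\infty}\|\mathbb{E}(T^n f\cdot\overline{g}|X) - T_0^n\mathbb{E}(f|X)\mathbb{E}(\overline{g}|X)\|_{L^2(X)} = 0$, where $T^nf = f\circ T^n$; $\mathcal{S}_{T_0}$ is the set of such extensions. *)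

theory Defs
  imports "HOL-Probability.Probability"
begin

definition MX :: "real measure" where
  "MX = restrict_space lborel {0..1}"

definition MZ :: "(real \<times> real) measure" where
  "MZ = MX \<Otimes>\<^sub>M MX"

definition FX :: "(real \<times> real) measure" where
  "FX = vimage_algebra (space MZ) fst MX"

definition inv_mpt :: "'a measure \<Rightarrow> ('a \<Rightarrow> 'a) set" where
  "inv_mpt W = {T. bij_betw T (space W) (space W) \<and> T \<in> W \<rightarrow>\<^sub>M W
      \<and> the_inv_into (space W) T \<in> W \<rightarrow>\<^sub>M W \<and> distr W W T = W}"

definition weak_top :: "'a measure \<Rightarrow> ('a \<Rightarrow> 'a) topology" where
  "weak_top W = topology_generated_by
     {{S \<in> inv_mpt W. measure W ((S ` E - T ` E) \<union> (T ` E - S ` E)) < e}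
        | T E e. T \<in> inv_mpt W \<and> E \<in> sets W \<and> e > 0}"

definition antiperiodic :: "(real \<Rightarrow> real) \<Rightarrow> bool" where
  "antiperiodic T0 \<longleftrightarrow>
     measure MX {x \<in> space MX. \<exists>n>0. (T0 ^^ n) x = x} = 0"

definition L2 :: "'a measure \<Rightarrow> ('a \<Rightarrow> complex) set" where
  "L2 W = {f. f \<in> borel_measurable W \<and> integrable W (\<lambda>x. (cmod (f x))\<^sup>2)}"

definition rigid :: "(real \<Rightarrow> real) \<Rightarrow> bool" where
  "rigid T0 \<longleftrightarrow> (\<exists>nk :: nat \<Rightarrow> nat. strict_mono nk \<and>
     (\<forall>f \<in> L2 MX. (\<lambda>k. sqrt (\<integral>x. (cmod (f ((T0 ^^ nk k) x) - f x))\<^sup>2 \<partial>MX))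
        \<longlonglongrightarrow> 0))"

definition ext_set :: "(real \<Rightarrow> real) \<Rightarrow> (real \<times> real \<Rightarrow> real \<times> real) set" where
  "ext_set T0 = {T \<in> inv_mpt MZ. (\<exists>Tx :: real \<Rightarrow> real \<Rightarrow> real.
      (\<forall>x\<in>space MX. Tx x \<in> inv_mpt MX) \<and>
      (\<forall>x\<in>space MX. \<forall>y\<in>space MX. T (x, y) = (T0 x, Tx x y)))}"

definition ext_top :: "(real \<Rightarrow> real) \<Rightarrow> (real \<times> real \<Rightarrow> real \<times> real) topology" where
  "ext_top T0 = subtopology (weak_top MZ) (ext_set T0)"

definition cond_X :: "(real \<times> real \<Rightarrow> complex) \<Rightarrow> (real \<times> real \<Rightarrow> complex)" where
  "cond_X f = (\<lambda>z. complex_of_real (real_cond_exp MZ FX (\<lambda>w. Re (f w)) z)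
                 + \<i> * complex_of_real (real_cond_exp MZ FX (\<lambda>w. Im (f w)) z))"

definition L2_rel :: "(real \<times> real \<Rightarrow> complex) set" where
  "L2_rel = {f \<in> L2 MZ. \<exists>C. AE z in MZ. sqrt (real_cond_exp MZ FX (\<lambda>w. (cmod (f w))\<^sup>2) z) \<le> C}"

definition strongly_mixing_ext :: "(real \<Rightarrow> real) \<Rightarrow> (real \<times> real \<Rightarrow> real \<times> real) \<Rightarrow> bool" where
  "strongly_mixing_ext T0 T \<longleftrightarrow> T \<in> ext_set T0 \<and>
     (\<forall>f \<in> L2_rel. \<forall>g \<in> L2_rel.
        (\<lambda>n. sqrt (\<integral>z. (cmod (cond_X (\<lambda>w. f ((T ^^ n) w) * cnj (g w)) z
              - cond_X f ((T0 ^^ n) (fst z), snd z) * cond_X (\<lambda>w. cnj (g w)) z))\<^sup>2 \<partial>MZ))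
        \<longlonglongrightarrow> 0)"

definition mixing_ext_set :: "(real \<Rightarrow> real) \<Rightarrow> (real \<times> real \<Rightarrow> real \<times> real) set" where
  "mixing_ext_set T0 = {T. strongly_mixing_ext T0 T}"

definition nowhere_dense_in :: "'a topology \<Rightarrow> 'a set \<Rightarrow> bool" where
  "nowhere_dense_in U A \<longleftrightarrow> U interior_of (U closure_of A) = {}"

definition first_category_in :: "'a topology \<Rightarrow> 'a set \<Rightarrow> bool" where
  "first_category_in U S \<longleftrightarrow> S \<subseteq> topspace U \<and>
     (\<exists>A :: nat \<Rightarrow> 'a set. (\<forall>n. nowhere_dense_in U (A n)) \<and> S \<subseteq> (\<Union>n. A n))"

end

theory Submission
  imports Defs
begin

text \<open>
  Put \<open>A = X \<times> [0, 1/2]\<close>. A strongly mixing extension has \<open>\<mu> (T\<^sup>k A \<inter> A) \<longlonglongrightarrow> 1/4\<close>, so it lies in one of the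
  closed sets of extensions with \<open>\<mu> (T\<^sup>k A \<inter> A) \<le> 3/8\<close> for all \<open>k \<ge> n\<close>. These have empty interior: if \<open>S\<close> acts
  on fibres only, then \<open>S\<^sup>-\<^sup>1 (T0 \<times> id) S\<close> inherits from \<open>T0\<close> the rigidity times \<open>n\<^sub>k\<close>, along which the measure
  tends to \<open>1/2\<close>; and such conjugates are dense, even uniformly, because an antiperiodic \<open>T0\<close> admits a small
  set meeting almost every backward orbit, and between two visits to it every extension can be
  conjugated to \<open>T0 \<times> id\<close>.
\<close>

section \<open>Invertible measure-preserving maps\<close>

text \<open>An explicit inverse \<open>T'\<close> is easier to exhibit than
  \<open>the_inv_into\<close>. The two agree on \<open>space W\<close>, and measurability only sees
  values there.\<close>

lemma inv_mptI:
  assumes "T \<in> W \<rightarrow>\<^sub>M W" "T' \<in> W \<rightarrow>\<^sub>M W"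
    and "\<And>x. x \<in> space W \<Longrightarrow> T' (T x) = x" "\<And>x. x \<in> space W \<Longrightarrow> T (T' x) = x"
    and "distr W W T = W"
  shows "T \<in> inv_mpt W"
proof -
  have sp: "T x \<in> space W" "T' x \<in> space W" if "x \<in> space W" for x
    using assms(1,2) that by (auto dest: measurable_space)
  have bij: "bij_betw T (space W) (space W)"
    by (rule bij_betw_byWitness[where f' = T']) (use assms sp in auto)
  have "the_inv_into (space W) T x = T' x" if "x \<in> space W" for x
    using bij sp[OF that] assms(4)[OF that] by (auto simp: bij_betw_def intro!: the_inv_into_f_eq)
  then have "the_inv_into (space W) T \<in> W \<rightarrow>\<^sub>M W"
    using assms(2) by (simp cong: measurable_cong)
  with bij assms show ?thesis by (simp add: inv_mpt_def)
qed

lemma inv_mptD: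
  assumes "T \<in> inv_mpt W"
  shows "bij_betw T (space W) (space W)" "T \<in> W \<rightarrow>\<^sub>M W" "distr W W T = W"
    "the_inv_into (space W) T \<in> W \<rightarrow>\<^sub>M W"
    "x \<in> space W \<Longrightarrow> T x \<in> space W"
    "x \<in> space W \<Longrightarrow> the_inv_into (space W) T x \<in> space W"
    "x \<in> space W \<Longrightarrow> the_inv_into (space W) T (T x) = x"
    "x \<in> space W \<Longrightarrow> T (the_inv_into (space W) T x) = x"
proof -
  show *: "bij_betw T (space W) (space W)" "T \<in> W \<rightarrow>\<^sub>M W" "distr W W T = W"
    "the_inv_into (space W) T \<in> W \<rightarrow>\<^sub>M W"
    using assms by (auto simp: inv_mpt_def)
  show "x \<in> space W \<Longrightarrow> T x \<in> space W" "x \<in> space W \<Longrightarrow> the_inv_into (space W) T x \<in> space W"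
    using *(2,4) by (auto dest: measurable_space)
  show "x \<in> space W \<Longrightarrow> the_inv_into (space W) T (T x) = x"
    "x \<in> space W \<Longrightarrow> T (the_inv_into (space W) T x) = x"
    using *(1) by (auto simp: bij_betw_def the_inv_into_f_f f_the_inv_into_f)
qed

lemma inv_mpt_the_inv_into:
  assumes "T \<in> inv_mpt W"
  shows "the_inv_into (space W) T \<in> inv_mpt W"
proof (rule inv_mptI)
  note T = inv_mptD[OF assms]
  let ?T' = "the_inv_into (space W) T"
  \<comment> \<open>Replacing \<open>W\<close> by its own push-forward under \<open>T\<close> lets
    the inverse cancel \<open>T\<close>.\<close>
  have "distr W W ?T' = distr (distr W W T) W ?T'" by (simp only: T(3))
  also have "\<dots> = distr W W (?T' \<circ> T)" by (rule distr_distr[OF T(4,2)])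
  also have "\<dots> = distr W W (\<lambda>x. x)" by (rule distr_cong) (auto simp: T)
  also have "\<dots> = W" by (simp add: distr_id)
  finally show "distr W W ?T' = W" .
qed (use inv_mptD[OF assms] in auto)

lemma inv_mpt_comp:
  assumes "S \<in> inv_mpt W" "T \<in> inv_mpt W"
  shows "S \<circ> T \<in> inv_mpt W"
proof (rule inv_mptI)
  note S = inv_mptD[OF assms(1)] and T = inv_mptD[OF assms(2)]
  show "S \<circ> T \<in> W \<rightarrow>\<^sub>M W" using S(2) T(2) by (rule measurable_comp[rotated])
  show "the_inv_into (space W) T \<circ> the_inv_into (space W) S \<in> W \<rightarrow>\<^sub>M W"
    using S(4) T(4) by (rule measurable_comp)
  show "distr W W (S \<circ> T) = W"
    using distr_distr[OF S(2) T(2)] S(3) T(3) by simp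
qed (use inv_mptD[OF assms(1)] inv_mptD[OF assms(2)] in auto)

lemma inv_mpt_cong:
  assumes "T \<in> inv_mpt W" "\<And>x. x \<in> space W \<Longrightarrow> S x = T x"
  shows "S \<in> inv_mpt W"
proof (rule inv_mptI)
  note T = inv_mptD[OF assms(1)]
  show "S \<in> W \<rightarrow>\<^sub>M W" using T(2) assms(2) by (simp cong: measurable_cong)
  show "distr W W S = W" using T(3) assms(2) by (metis distr_cong)
  show "the_inv_into (space W) T \<in> W \<rightarrow>\<^sub>M W" by (rule T(4))
qed (use inv_mptD[OF assms(1)] assms(2) in auto)

lemma inv_mpt_id: "id \<in> inv_mpt W"
  by (rule inv_mptI[where T' = id]) (auto simp: id_def distr_id)

lemma inv_mpt_funpow: "T \<in> inv_mpt W \<Longrightarrow> T ^^ n \<in> inv_mpt W"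
  by (induction n) (auto simp: inv_mpt_id inv_mpt_comp)

lemma funpow_the_inv_into:
  assumes "T \<in> inv_mpt W" "x \<in> space W"
  shows "(the_inv_into (space W) T ^^ n) ((T ^^ n) x) = x"
    "(T ^^ n) ((the_inv_into (space W) T ^^ n) x) = x"
proof -
  note T = inv_mptD[OF assms(1)]
    and p = inv_mptD(5)[OF inv_mpt_funpow[OF assms(1)]]
    and q = inv_mptD(5)[OF inv_mpt_funpow[OF inv_mpt_the_inv_into[OF assms(1)]]]
  show "(the_inv_into (space W) T ^^ n) ((T ^^ n) x) = x"
  proof (induction n)
    case (Suc n)
    then show ?case
      using T(7)[OF p[OF assms(2), of n]]
      by (simp only: funpow.simps(2)[of n T] funpow_Suc_right[of n "the_inv_into (space W) T"] o_apply)
  qed simp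
  show "(T ^^ n) ((the_inv_into (space W) T ^^ n) x) = x"
  proof (induction n)
    case (Suc n)
    then show ?case
      using T(8)[OF q[OF assms(2), of n]]
      by (simp only: funpow_Suc_right[of n T] funpow.simps(2)[of n "the_inv_into (space W) T"] o_apply)
  qed simp
qed

text \<open>The weak topology is phrased with images, measurability with preimages; the inverse map
  passes from one to the other.\<close>

lemma inv_mpt_image_eq:
  assumes "T \<in> inv_mpt W" "E \<subseteq> space W"
  shows "T ` E = the_inv_into (space W) T -` E \<inter> space W"
proof (intro equalityI subsetI)
  fix y assume "y \<in> T ` E"
  then obtain x where "x \<in> E" "y = T x" by auto
  then show "y \<in> the_inv_into (space W) T -` E \<inter> space W"
    using inv_mptD(5,7)[OF assms(1), of x] assms(2) by auto
next
  fix y assume "y \<in> the_inv_into (space W) T -` E \<inter> space W"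
  then show "y \<in> T ` E"
    using inv_mptD(8)[OF assms(1), of y] by (auto intro!: image_eqI[of _ _ "the_inv_into (space W) T y"])
qed

lemma inv_mpt_measure_vimage:
  assumes "T \<in> inv_mpt W" "E \<in> sets W"
  shows "measure W (T -` E \<inter> space W) = measure W E"
  using measure_distr[OF inv_mptD(2)[OF assms(1)] assms(2)] inv_mptD(3)[OF assms(1)] by simp

lemma inv_mpt_image:
  assumes "T \<in> inv_mpt W" "E \<in> sets W"
  shows "T ` E \<in> sets W" "measure W (T ` E) = measure W E"
proof -
  have eq: "T ` E = the_inv_into (space W) T -` E \<inter> space W"
    by (rule inv_mpt_image_eq[OF assms(1) sets.sets_into_space[OF assms(2)]])
  show "T ` E \<in> sets W"
    unfolding eq using inv_mptD(4)[OF assms(1)] assms(2) by (rule measurable_sets)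
  show "measure W (T ` E) = measure W E"
    unfolding eq by (rule inv_mpt_measure_vimage[OF inv_mpt_the_inv_into[OF assms(1)] assms(2)])
qed

text \<open>Both sides measure the points of \<open>E\<close> that \<open>T\<close> sends into
  \<open>F\<close>, after and before applying \<open>T\<close>. This links the image form of the
  topology to the preimage form in which rigidity and mixing appear.\<close>

lemma inv_mpt_measure_image_Int:
  assumes "T \<in> inv_mpt W" "E \<in> sets W" "F \<in> sets W"
  shows "measure W (T ` E \<inter> F) = measure W (E \<inter> (T -` F \<inter> space W))"
proof -
  have "T ` E \<inter> F = T ` (E \<inter> (T -` F \<inter> space W))"
    using sets.sets_into_space[OF assms(2)] by auto
  moreover have "E \<inter> (T -` F \<inter> space W) \<in> sets W"
    using assms inv_mptD(2)[OF assms(1)] by (auto intro!: sets.Int measurable_sets)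
  ultimately show ?thesis
    by (metis inv_mpt_image(2)[OF assms(1)])
qed

section \<open>The weak topology\<close>

lemma (in finite_measure) measure_sym_diff_triangle:
  assumes "A \<in> sets M" "B \<in> sets M" "C \<in> sets M"
  shows "measure M (sym_diff A C) \<le> measure M (sym_diff A B) + measure M (sym_diff B C)"
proof -
  have "measure M (sym_diff A C) \<le> measure M (sym_diff A B \<union> sym_diff B C)"
    using assms by (intro finite_measure_mono) auto
  also have "\<dots> \<le> measure M (sym_diff A B) + measure M (sym_diff B C)"
    using assms by (intro measure_Un_le) auto
  finally show ?thesis .
qed

lemma openin_weak_top_basic:
  assumes "T \<in> inv_mpt W" "E \<in> sets W" "e > 0"
  shows "openin (weak_top W) {S \<in> inv_mpt W. measure W (sym_diff (S ` E) (T ` E)) < e}"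
  unfolding weak_top_def using assms by (intro topology_generated_by_Basis) blast

lemma topspace_weak_top: "topspace (weak_top W) = inv_mpt W"
proof
  show "topspace (weak_top W) \<subseteq> inv_mpt W"
    unfolding weak_top_def topology_generated_by_topspace by blast
  \<comment> \<open>With \<open>E = {}\<close> the subbasic condition always holds, so one subbasic
    set is already all of \<open>inv_mpt W\<close>.\<close>
  have "openin (weak_top W) {S \<in> inv_mpt W. measure W (sym_diff (S ` {}) (id ` {})) < 1}"
    by (intro openin_weak_top_basic inv_mpt_id) auto
  then show "inv_mpt W \<subseteq> topspace (weak_top W)"
    by (auto dest!: openin_subset)
qed

text \<open>A basic neighbourhood involves only finitely many test sets \<open>E\<close>, so
  closeness uniform over all \<open>E\<close> is more than enough. Density can then be proved with a
  bound that ignores the test sets.\<close>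

lemma weak_top_uniform_nbhd:
  assumes "finite_measure W" "openin (weak_top W) U" "T \<in> U"
  shows "\<exists>e>0. \<forall>S\<in>inv_mpt W.
    (\<forall>E\<in>sets W. measure W (sym_diff (S ` E) (T ` E)) < e) \<longrightarrow> S \<in> U"
proof -
  interpret finite_measure W by fact
  have "generate_topology_on {{S \<in> inv_mpt W. measure W (sym_diff (S ` E) (T ` E)) < e}
         | T E e. T \<in> inv_mpt W \<and> E \<in> sets W \<and> e > 0} U"
    using assms(2) unfolding weak_top_def by (rule openin_topology_generated_by)
  then show ?thesis using \<open>T \<in> U\<close>
  proof (induction rule: generate_topology_on.induct)
    case (Int A B)
    then obtain a b where "a > 0" "b > 0"
      "\<forall>S\<in>inv_mpt W. (\<forall>E\<in>sets W. measure W (sym_diff (S ` E) (T ` E)) < a) \<longrightarrow> S \<in> A"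
      "\<forall>S\<in>inv_mpt W. (\<forall>E\<in>sets W. measure W (sym_diff (S ` E) (T ` E)) < b) \<longrightarrow> S \<in> B"
      by blast
    then show ?case by (intro exI[of _ "min a b"]) auto
  next
    case (UN K)
    then obtain A where A: "A \<in> K" "T \<in> A" by blast
    then obtain e where "e > 0"
      "\<forall>S\<in>inv_mpt W. (\<forall>E\<in>sets W. measure W (sym_diff (S ` E) (T ` E)) < e) \<longrightarrow> S \<in> A"
      using UN by blast
    then show ?case using A by blast
  next
    case (Basis A)
    then obtain R E r where A: "A = {S \<in> inv_mpt W. measure W (sym_diff (S ` E) (R ` E)) < r}"
      and R: "R \<in> inv_mpt W" "E \<in> sets W" by blast
    have T: "T \<in> inv_mpt W" "measure W (sym_diff (T ` E) (R ` E)) < r"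
      using Basis(2) unfolding A by auto
    show ?case
    \<comment> \<open>The subbasic set is centred at some \<open>R\<close>, not at \<open>T\<close>,
      so the radius is what the triangle inequality leaves over.\<close>
    proof (intro exI[of _ "r - measure W (sym_diff (T ` E) (R ` E))"] conjI ballI impI)
      fix S assume S: "S \<in> inv_mpt W" and "\<forall>F\<in>sets W. measure W (sym_diff (S ` F) (T ` F))
          < r - measure W (sym_diff (T ` E) (R ` E))"
      then have "measure W (sym_diff (S ` E) (T ` E)) < r - measure W (sym_diff (T ` E) (R ` E))"
        using R by blast
      then show "S \<in> A"
        unfolding A using measure_sym_diff_triangle[of "S ` E" "T ` E" "R ` E"] S R T
        by (auto simp: inv_mpt_image)
    qed (use T in auto)
  qed simp
qed

text \<open>Induction on \<open>k\<close> through the image of \<open>?E\<close> under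
  \<open>S\<close>: applying \<open>S\<close> preserves the distance already controlled, and one
  more subbasic condition, at the fixed set \<open>?E\<close>, compares \<open>S\<close> with
  \<open>T\<close>. Each part costs \<open>e / 2\<close>.\<close>

lemma weak_top_funpow_nbhd:
  assumes "finite_measure W" "T \<in> inv_mpt W" "E \<in> sets W" "e > 0"
  shows "\<exists>U. openin (weak_top W) U \<and> T \<in> U \<and>
    (\<forall>S\<in>U. measure W (sym_diff ((S ^^ k) ` E) ((T ^^ k) ` E)) < e)"
  using \<open>e > 0\<close>
proof (induction k arbitrary: e)
  case 0
  then show ?case
    using openin_topspace[of "weak_top W"] assms(2) by (intro exI[of _ "inv_mpt W"]) (auto simp: topspace_weak_top)
next
  case (Suc k)
  interpret finite_measure W by fact
  let ?E = "(T ^^ k) ` E"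
  have E: "?E \<in> sets W"
    using inv_mpt_image(1)[OF inv_mpt_funpow[OF assms(2)] assms(3)] .
  obtain U where U: "openin (weak_top W) U" "T \<in> U"
    "\<forall>S\<in>U. measure W (sym_diff ((S ^^ k) ` E) ?E) < e / 2"
    using Suc.IH[of "e / 2"] Suc.prems by auto
  define V where "V = {S \<in> inv_mpt W. measure W (sym_diff (S ` ?E) (T ` ?E)) < e / 2}"
  show ?case
  proof (intro exI[of _ "U \<inter> V"] conjI ballI)
    show "openin (weak_top W) (U \<inter> V)"
      unfolding V_def using U(1) assms(2) E Suc.prems by (intro openin_Int openin_weak_top_basic) auto
    show "T \<in> U \<inter> V" using U(2) assms(2) Suc.prems by (simp add: V_def)
    fix S assume S: "S \<in> U \<inter> V"
    then have SW: "S \<in> inv_mpt W" by (simp add: V_def)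
    have F: "(S ^^ k) ` E \<in> sets W"
      using inv_mpt_image(1)[OF inv_mpt_funpow[OF SW] assms(3)] .
    have inj: "inj_on S (space W)" using inv_mptD(1)[OF SW] by (simp add: bij_betw_def)
    have sub: "(S ^^ k) ` E \<subseteq> space W" "?E \<subseteq> space W"
      using E F sets.sets_into_space by auto
    have "S ` (A - B) = S ` A - S ` B" if "A \<subseteq> space W" "B \<subseteq> space W" for A B
      using that by (intro inj_on_image_set_diff[OF inj]) auto
    then have "sym_diff (S ` (S ^^ k) ` E) (S ` ?E) = S ` sym_diff ((S ^^ k) ` E) ?E"
      using sub by (simp only: image_Un)
    then have "measure W (sym_diff (S ` (S ^^ k) ` E) (S ` ?E)) = measure W (sym_diff ((S ^^ k) ` E) ?E)"
      using inv_mpt_image(2)[OF SW, of "sym_diff ((S ^^ k) ` E) ?E"] E F by auto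
    also have "\<dots> < e / 2" using U(3) S by blast
    moreover have "measure W (sym_diff (S ` ?E) (T ` ?E)) < e / 2" using S by (simp add: V_def)
    ultimately have "measure W (sym_diff (S ` (S ^^ k) ` E) (T ` ?E)) < e"
      using measure_sym_diff_triangle[of "S ` (S ^^ k) ` E" "S ` ?E" "T ` ?E"] E F SW assms(2)
      by (simp add: inv_mpt_image)
    then show "measure W (sym_diff ((S ^^ Suc k) ` E) ((T ^^ Suc k) ` E)) < e"
      by (simp add: image_comp)
  qed
qed

text \<open>The overlap with \<open>F\<close> changes by at most the measure of the symmetric
  difference of the iterated images. Openness here makes the sets of non-returning extensions
  closed.\<close>

lemma openin_weak_top_return:
  assumes "finite_measure W" "E \<in> sets W" "F \<in> sets W"
  shows "openin (weak_top W) {T \<in> inv_mpt W. measure W ((T ^^ k) ` E \<inter> F) > c}"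
proof (subst openin_subopen, intro ballI)
  interpret finite_measure W by fact
  fix T assume T: "T \<in> {T \<in> inv_mpt W. measure W ((T ^^ k) ` E \<inter> F) > c}"
  then obtain U where U: "openin (weak_top W) U" "T \<in> U"
    "\<And>S. S \<in> U \<Longrightarrow> measure W (sym_diff ((S ^^ k) ` E) ((T ^^ k) ` E)) < measure W ((T ^^ k) ` E \<inter> F) - c"
    using weak_top_funpow_nbhd[OF assms(1) _ assms(2), of T "measure W ((T ^^ k) ` E \<inter> F) - c" k] by auto
  have "measure W ((S ^^ k) ` E \<inter> F) > c" if "S \<in> U" "S \<in> inv_mpt W" for S
  proof -
    have s: "(S ^^ k) ` E \<in> sets W" "(T ^^ k) ` E \<in> sets W"
      using T that assms(2) by (auto intro!: inv_mpt_image inv_mpt_funpow)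
    have "measure W ((T ^^ k) ` E \<inter> F)
        \<le> measure W (((S ^^ k) ` E \<inter> F) \<union> sym_diff ((S ^^ k) ` E) ((T ^^ k) ` E))"
      using s assms(3) by (intro finite_measure_mono) auto
    also have "\<dots> \<le> measure W ((S ^^ k) ` E \<inter> F) + measure W (sym_diff ((S ^^ k) ` E) ((T ^^ k) ` E))"
      using s assms(3) by (intro measure_Un_le) auto
    finally show ?thesis using U(3)[OF that(1)] by simp
  qed
  moreover have "U \<subseteq> inv_mpt W" using openin_subset[OF U(1)] by (simp add: topspace_weak_top)
  ultimately show "\<exists>U. openin (weak_top W) U \<and> T \<in> U \<and> U \<subseteq> {T \<in> inv_mpt W. measure W ((T ^^ k) ` E \<inter> F) > c}"
    using U by (intro exI[of _ U]) auto
qed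

section \<open>Extensions\<close>

lemma space_MX: "space MX = {0..1}"
  by (simp add: MX_def space_restrict_space)

lemma space_MZ: "space MZ = space MX \<times> space MX"
  by (simp add: MZ_def space_pair_measure)

lemma prob_space_MX: "prob_space MX"
  by (rule prob_spaceI) (simp add: MX_def emeasure_restrict_space space_restrict_space)

interpretation X: prob_space MX by (rule prob_space_MX)
interpretation XX: pair_prob_space MX MX ..

lemma prob_space_MZ: "prob_space MZ"
  unfolding MZ_def by (rule XX.prob_space_axioms)

interpretation Z: prob_space MZ by (rule prob_space_MZ)

lemma measurable_fst_MZ [measurable]: "fst \<in> MZ \<rightarrow>\<^sub>M MX"
  by (simp add: MZ_def)

text \<open>\<open>bchoice\<close> trades the family of fibre maps for pointwise existence, so that
  fibres can be treated one \<open>x\<close> at a time; joint measurability is carried by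
  \<open>inv_mpt MZ\<close>.\<close>

lemma ext_set_iff:
  "T \<in> ext_set T0 \<longleftrightarrow> T \<in> inv_mpt MZ \<and>
    (\<forall>x\<in>space MX. \<exists>V\<in>inv_mpt MX. \<forall>y\<in>space MX. T (x, y) = (T0 x, V y))"
proof -
  have "(\<forall>x\<in>space MX. \<exists>V\<in>inv_mpt MX. \<forall>y\<in>space MX. T (x, y) = (T0 x, V y)) \<longleftrightarrow>
    (\<exists>V. \<forall>x\<in>space MX. V x \<in> inv_mpt MX \<and> (\<forall>y\<in>space MX. T (x, y) = (T0 x, V x y)))"
    using bchoice[of "space MX" "\<lambda>x V. V \<in> inv_mpt MX \<and> (\<forall>y\<in>space MX. T (x, y) = (T0 x, V y))"]
    by blast
  then show ?thesis by (auto simp: ext_set_def)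
qed

lemma ext_setD:
  assumes "T \<in> ext_set T0"
  shows "T \<in> inv_mpt MZ" "z \<in> space MZ \<Longrightarrow> fst (T z) = T0 (fst z)"
    "x \<in> space MX \<Longrightarrow> T0 x \<in> space MX"
proof -
  show *: "fst (T z) = T0 (fst z)" if "z \<in> space MZ" for z
    using assms that by (cases z; force simp: ext_set_iff space_MZ)
  show T: "T \<in> inv_mpt MZ" using assms by (simp add: ext_set_iff)
  show "x \<in> space MX \<Longrightarrow> T0 x \<in> space MX"
    using *[of "(x, x)"] inv_mptD(5)[OF T, of "(x, x)"] by (auto simp: space_MZ mem_Times_iff)
qed

text \<open>Base maps built from inverses equal the intended map only on \<open>space MX\<close>;
  this allows the exchange.\<close>

lemma ext_set_cong:
  assumes "T \<in> ext_set T0" "\<And>x. x \<in> space MX \<Longrightarrow> S0 x = T0 x"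
  shows "T \<in> ext_set S0"
  using assms by (simp add: ext_set_iff)

lemma ext_set_comp:
  assumes "S \<in> ext_set S0" "T \<in> ext_set T0"
  shows "S \<circ> T \<in> ext_set (S0 \<circ> T0)"
  unfolding ext_set_iff
proof (intro conjI ballI)
  show "S \<circ> T \<in> inv_mpt MZ" using assms by (intro inv_mpt_comp ext_setD(1))
  fix x assume x: "x \<in> space MX"
  obtain V where V: "V \<in> inv_mpt MX" "\<forall>y\<in>space MX. T (x, y) = (T0 x, V y)"
    using assms(2) x by (auto simp: ext_set_iff)
  obtain U where U: "U \<in> inv_mpt MX" "\<forall>y\<in>space MX. S (T0 x, y) = (S0 (T0 x), U y)"
    using assms(1) ext_setD(3)[OF assms(2) x] by (auto simp: ext_set_iff)
  show "\<exists>V\<in>inv_mpt MX. \<forall>y\<in>space MX. (S \<circ> T) (x, y) = ((S0 \<circ> T0) x, V y)"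
    using U V inv_mptD(5)[OF V(1)] by (intro bexI[of _ "U \<circ> V"] inv_mpt_comp) auto
qed

lemma ext_set_funpow: "T \<in> ext_set T0 \<Longrightarrow> T ^^ n \<in> ext_set (T0 ^^ n)"
proof (induction n)
  case 0
  show ?case using inv_mpt_id[of MZ] inv_mpt_id[of MX] by (force simp: ext_set_iff id_def)
qed (simp add: ext_set_comp)

lemma ext_set_the_inv_into:
  assumes "T \<in> ext_set T0" "T0 \<in> inv_mpt MX"
  shows "the_inv_into (space MZ) T \<in> ext_set (the_inv_into (space MX) T0)"
  unfolding ext_set_iff
proof (intro conjI ballI)
  note T = inv_mptD[OF ext_setD(1)[OF assms(1)]] and T0 = inv_mptD[OF assms(2)]
  show "the_inv_into (space MZ) T \<in> inv_mpt MZ"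
    using assms by (intro inv_mpt_the_inv_into ext_setD(1))
  fix x assume x: "x \<in> space MX"
  let ?x = "the_inv_into (space MX) T0 x"
  obtain V where V: "V \<in> inv_mpt MX" "\<forall>y\<in>space MX. T (?x, y) = (T0 ?x, V y)"
    using assms(1) T0(6)[OF x] by (auto simp: ext_set_iff)
  note V' = inv_mptD[OF V(1)]
  have "the_inv_into (space MZ) T (x, y) = (?x, the_inv_into (space MX) V y)" if y: "y \<in> space MX" for y
    using T(7)[of "(?x, the_inv_into (space MX) V y)"] V(2) V'(6,8)[OF y] T0(6,8)[OF x]
    by (simp add: space_MZ)
  then show "\<exists>V\<in>inv_mpt MX. \<forall>y\<in>space MX. the_inv_into (space MZ) T (x, y) = (?x, V y)"
    using inv_mpt_the_inv_into[OF V(1)] by blast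
qed

lemma ext_set_times_id:
  assumes "T0 \<in> inv_mpt MX"
  shows "(\<lambda>(x, y). (T0 x, y)) \<in> ext_set T0"
  unfolding ext_set_iff
proof (intro conjI ballI)
  note T0 = inv_mptD[OF assms]
  show "(\<lambda>(x, y). (T0 x, y)) \<in> inv_mpt MZ"
  proof (rule inv_mptI)
    show "(\<lambda>(x, y). (T0 x, y)) \<in> MZ \<rightarrow>\<^sub>M MZ"
      "(\<lambda>(x, y). (the_inv_into (space MX) T0 x, y)) \<in> MZ \<rightarrow>\<^sub>M MZ"
      unfolding MZ_def using T0(2,4) by measurable
    have "distr MX MX T0 \<Otimes>\<^sub>M distr MX MX (\<lambda>y. y) = distr (MX \<Otimes>\<^sub>M MX) (MX \<Otimes>\<^sub>M MX) (\<lambda>(x, y). (T0 x, y))"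
      by (rule pair_measure_distr) (use T0 in \<open>auto simp: distr_id X.sigma_finite_measure_axioms\<close>)
    then show "distr MZ MZ (\<lambda>(x, y). (T0 x, y)) = MZ"
      by (simp add: MZ_def T0(3) distr_id)
  qed (auto simp: space_MZ T0)
  show "\<exists>V\<in>inv_mpt MX. \<forall>y\<in>space MX. (\<lambda>(x, y). (T0 x, y)) (x, y) = (T0 x, V y)" for x
    by (intro bexI[OF _ inv_mpt_id]) auto
qed

text \<open>Every \<open>F n\<close> keeps the base coordinate, so the piece where \<open>N\<close>
  equals \<open>n\<close> is mapped onto itself. Hence the inverses can be glued along the same
  \<open>N\<close>, and measure is preserved piece by piece.\<close>

lemma ext_set_piecewise:
  fixes N :: "real \<Rightarrow> nat"
  assumes [measurable]: "N \<in> MX \<rightarrow>\<^sub>M count_space UNIV" and F: "\<And>n. F n \<in> ext_set id"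
  shows "(\<lambda>z. F (N (fst z)) z) \<in> ext_set id"
  unfolding ext_set_iff
proof (intro conjI ballI)
  let ?S = "\<lambda>z. F (N (fst z)) z"
  let ?F' = "\<lambda>n. the_inv_into (space MZ) (F n)"
  have F': "?F' n \<in> ext_set id" for n
  proof -
    have "?F' n \<in> ext_set (the_inv_into (space MX) id)"
      using F by (rule ext_set_the_inv_into) (rule inv_mpt_id)
    then show ?thesis
      by (rule ext_set_cong) (use inv_mptD(7)[OF inv_mpt_id, of _ MX] in simp)
  qed
  have F_fst: "fst (F n z) = fst z" "fst (?F' n z) = fst z" if "z \<in> space MZ" for n z
    using ext_setD(2)[OF F that] ext_setD(2)[OF F' that] by auto
  have F_meas: "F n \<in> MZ \<rightarrow>\<^sub>M MZ" "?F' n \<in> MZ \<rightarrow>\<^sub>M MZ" for n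
    using inv_mptD(2,4)[OF ext_setD(1)[OF F]] by auto
  have NZ: "(\<lambda>z. N (fst z)) \<in> MZ \<rightarrow>\<^sub>M count_space UNIV" by measurable
  show "?S \<in> inv_mpt MZ"
  proof (rule inv_mptI)
    show S_meas: "?S \<in> MZ \<rightarrow>\<^sub>M MZ"
      by (rule measurable_compose_countable[OF F_meas(1) NZ])
    show "(\<lambda>z. ?F' (N (fst z)) z) \<in> MZ \<rightarrow>\<^sub>M MZ"
      by (rule measurable_compose_countable[OF F_meas(2) NZ])
    show "?F' (N (fst (?S z))) (?S z) = z" "?S (?F' (N (fst z)) z) = z" if "z \<in> space MZ" for z
      using F_fst[OF that] inv_mptD(7,8)[OF ext_setD(1)[OF F] that] by simp_all
    show "distr MZ MZ ?S = MZ"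
    proof (rule measure_eqI)
      fix A assume "A \<in> sets (distr MZ MZ ?S)"
      then have A: "A \<in> sets MZ" by simp
      let ?X = "\<lambda>n. {z \<in> space MZ. N (fst z) = n}"
      have X: "?X n \<in> sets MZ" for n by measurable
      have "emeasure (distr MZ MZ ?S) A = emeasure MZ (?S -` A \<inter> space MZ)"
        using S_meas A by (rule emeasure_distr)
      also have "?S -` A \<inter> space MZ = (\<Union>n. F n -` (A \<inter> ?X n) \<inter> space MZ)"
      proof (rule set_eqI)
        fix z
        show "z \<in> ?S -` A \<inter> space MZ \<longleftrightarrow> z \<in> (\<Union>n. F n -` (A \<inter> ?X n) \<inter> space MZ)"
          by (cases "z \<in> space MZ") (simp_all add: F_fst inv_mptD(5)[OF ext_setD(1)[OF F]])
      qed
      also have "emeasure MZ \<dots> = (\<Sum>n. emeasure MZ (F n -` (A \<inter> ?X n) \<inter> space MZ))"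
      proof (rule suminf_emeasure[symmetric])
        show "range (\<lambda>n. F n -` (A \<inter> ?X n) \<inter> space MZ) \<subseteq> sets MZ"
          using F_meas(1) A X by (auto intro!: measurable_sets)
        show "disjoint_family (\<lambda>n. F n -` (A \<inter> ?X n) \<inter> space MZ)"
          unfolding disjoint_family_on_def
        proof (intro ballI impI equals0I)
          fix m n :: nat and z
          assume "m \<noteq> n" "z \<in> (F m -` (A \<inter> ?X m) \<inter> space MZ) \<inter> (F n -` (A \<inter> ?X n) \<inter> space MZ)"
          moreover from this have "z \<in> space MZ" by simp
          ultimately show False by (simp add: F_fst)
        qed
      qed
      also have "\<dots> = (\<Sum>n. emeasure MZ (A \<inter> ?X n))"
      proof (rule suminf_cong)
        fix n
        have "emeasure MZ (F n -` (A \<inter> ?X n) \<inter> space MZ) = emeasure (distr MZ MZ (F n)) (A \<inter> ?X n)"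
          using F_meas(1) A X by (intro emeasure_distr[symmetric]) auto
        then show "emeasure MZ (F n -` (A \<inter> ?X n) \<inter> space MZ) = emeasure MZ (A \<inter> ?X n)"
          using inv_mptD(3)[OF ext_setD(1)[OF F]] by simp
      qed
      also have "\<dots> = emeasure MZ (\<Union>n. A \<inter> ?X n)"
        using A X by (intro suminf_emeasure) (auto simp: disjoint_family_on_def)
      also have "(\<Union>n. A \<inter> ?X n) = A"
        using sets.sets_into_space[OF A] by auto
      finally show "emeasure (distr MZ MZ ?S) A = emeasure MZ A" .
    qed simp
  qed
  fix x assume "x \<in> space MX"
  then show "\<exists>V\<in>inv_mpt MX. \<forall>y\<in>space MX. ?S (x, y) = (id x, V y)"
    using F[of "N x"] by (auto simp: ext_set_iff)
qed

section \<open>Sweeping sets of antiperiodic maps\<close>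

text \<open>Rational endpoints keep the family of separating intervals countable, so that it can be
  listed by natural numbers.\<close>

lemma exists_rational_interval:
  fixes x :: real
  assumes "finite F" "x \<notin> F"
  shows "\<exists>p q :: rat. x \<in> {of_rat p<..<of_rat q} \<and> {of_rat p<..<of_rat q} \<inter> F = {}"
proof -
  have "open (- F)" using assms(1) by (simp add: finite_imp_closed open_Compl)
  then obtain e where e: "e > 0" "ball x e \<subseteq> - F"
    using assms(2) by (auto simp: open_contains_ball)
  obtain p where p: "x - e < of_rat p" "of_rat p < x"
    using of_rat_dense[of "x - e" x] e(1) by auto
  obtain q where q: "x < of_rat q" "of_rat q < x + e"
    using of_rat_dense[of x "x + e"] e(1) by auto
  have "{of_rat p<..<of_rat q} \<subseteq> ball x e"
    using p q by (auto simp: dist_real_def)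
  then show ?thesis using p q e by (intro exI[of _ p] exI[of _ q]) auto
qed

text \<open>
  A weak form of Rokhlin's lemma. Let \<open>A j\<close> list the sets of points of a rational interval that do
  not return to it within \<open>N\<close> steps; they cover all aperiodic points. Every orbit picks the first
  \<open>A j\<close> that it visits. The points of orbits lying in the chosen set form \<open>C\<close>, which is disjoint from
  its first \<open>N\<close> translates, hence small, and by recurrence almost every point has a visit to \<open>C\<close> in
  its past. The exceptional null set is closed under the inverse and is added to \<open>C\<close>.
\<close>

lemma sweeping_set:
  assumes T: "T \<in> inv_mpt MX" and "antiperiodic T" and "e > 0"
  defines "T' \<equiv> the_inv_into (space MX) T"
  shows "\<exists>C\<in>sets MX. measure MX C < e \<and> (\<forall>x\<in>space MX. \<exists>n. (T' ^^ Suc n) x \<in> C)"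
proof -
  \<comment> \<open>\<open>N + 1\<close> disjoint sets of the measure of \<open>C\<close> in a
    probability space will force \<open>measure MX C \<le> 1 / (N + 1) < e\<close>.\<close>
  obtain N where N: "inverse (real (Suc N)) < e"
    using reals_Archimedean[OF \<open>e > 0\<close>] by blast
  have T'_inv: "T' \<in> inv_mpt MX" unfolding T'_def using T by (rule inv_mpt_the_inv_into)
  have T'T: "T' (T x) = x" if "x \<in> space MX" for x
    unfolding T'_def using T that by (rule inv_mptD)
  have Tn_meas [measurable]: "T ^^ n \<in> MX \<rightarrow>\<^sub>M MX" "T' ^^ n \<in> MX \<rightarrow>\<^sub>M MX" for n
    by (rule inv_mptD(2)[OF inv_mpt_funpow[OF T]], rule inv_mptD(2)[OF inv_mpt_funpow[OF T'_inv]])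
  have sp: "(T ^^ n) x \<in> space MX" "(T' ^^ n) x \<in> space MX" if "x \<in> space MX" for n x
    by (rule inv_mptD(5)[OF inv_mpt_funpow[OF T] that], rule inv_mptD(5)[OF inv_mpt_funpow[OF T'_inv] that])
  have sp1: "T x \<in> space MX" "T' x \<in> space MX" if "x \<in> space MX" for x
    using sp[OF that, of 1] by auto
  have borel [measurable]: "(\<lambda>x. x) \<in> MX \<rightarrow>\<^sub>M borel"
    unfolding MX_def by (intro measurable_restrict_space1) simp
  have Tn_borel [measurable]: "T ^^ n \<in> MX \<rightarrow>\<^sub>M borel" for n
    using measurable_compose[OF Tn_meas(1) borel] by simp

  define I :: "nat \<Rightarrow> real set" where
    "I j = (case from_nat j of (p, q) \<Rightarrow> {real_of_rat p<..<real_of_rat q})" for j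
  have I [measurable]: "I j \<in> sets borel" for j by (auto simp: I_def split: prod.split)
  define A where "A j = {x \<in> space MX. x \<in> I j \<and> (\<forall>k\<in>{1..N}. (T ^^ k) x \<notin> I j)}" for j
  have A [measurable]: "A j \<in> sets MX" for j unfolding A_def by measurable
  define V where "V j = {x \<in> space MX. \<exists>n. (T ^^ n) x \<in> A j \<or> (T' ^^ n) x \<in> A j}" for j
  have V [measurable]: "V j \<in> sets MX" for j unfolding V_def by measurable
  have AV: "A j \<subseteq> V j" for j
    unfolding V_def by (auto simp: A_def intro!: exI[of _ 0])

  \<comment> \<open>\<open>V j\<close> counts visits in both time directions, so it is a union of
    full orbits. In the cases \<open>n = 0\<close> the step by \<open>T\<close> moves a visit from
    one time direction to the other.\<close>
  have V_T: "T x \<in> V j \<longleftrightarrow> x \<in> V j" if x: "x \<in> space MX" for x j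
  proof
    assume "T x \<in> V j"
    then obtain n where "(T ^^ n) (T x) \<in> A j \<or> (T' ^^ n) (T x) \<in> A j" by (auto simp: V_def)
    then show "x \<in> V j"
    proof
      assume "(T ^^ n) (T x) \<in> A j"
      then have "(T ^^ Suc n) x \<in> A j" by (simp add: funpow_swap1)
      then show ?thesis using x unfolding V_def by blast
    next
      assume *: "(T' ^^ n) (T x) \<in> A j"
      show ?thesis
      proof (cases n)
        case 0
        then have "(T ^^ 1) x \<in> A j" using * by simp
        then show ?thesis using x unfolding V_def by blast
      next
        case (Suc m)
        then have "(T' ^^ m) x \<in> A j" using * T'T[OF x] by (simp add: funpow_swap1)
        then show ?thesis using x unfolding V_def by blast
      qed
    qed
  next
    assume "x \<in> V j"
    then obtain n where "(T ^^ n) x \<in> A j \<or> (T' ^^ n) x \<in> A j" by (auto simp: V_def)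
    then show "T x \<in> V j"
    proof
      assume *: "(T' ^^ n) x \<in> A j"
      then have "(T' ^^ Suc n) (T x) \<in> A j" using T'T[OF x] by (simp add: funpow_swap1)
      then show ?thesis using sp1[OF x] unfolding V_def by blast
    next
      assume *: "(T ^^ n) x \<in> A j"
      show ?thesis
      proof (cases n)
        case 0
        then have "(T' ^^ 1) (T x) \<in> A j" using * T'T[OF x] by simp
        then show ?thesis using sp1[OF x] unfolding V_def by blast
      next
        case (Suc m)
        then have "(T ^^ m) (T x) \<in> A j" using * by (simp add: funpow_swap1)
        then show ?thesis using sp1[OF x] unfolding V_def by blast
      qed
    qed
  qed
  have V_Tn: "(T ^^ n) x \<in> V j \<longleftrightarrow> x \<in> V j" if "x \<in> space MX" for x j n
    by (induction n) (simp_all add: V_T sp that)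
  have V_T'n: "(T' ^^ n) x \<in> V j \<longleftrightarrow> x \<in> V j" if "x \<in> space MX" for x j n
    using V_Tn[OF sp(2)[OF that], of n n] funpow_the_inv_into(2)[OF T that] by (simp add: T'_def)

  define C where "C = {x \<in> space MX. \<exists>j. x \<in> A j \<and> (\<forall>i<j. x \<notin> V i)}"
  have C [measurable]: "C \<in> sets MX" unfolding C_def by measurable
  \<comment> \<open>Points of one orbit select the same index because every \<open>V j\<close> is
    invariant, and \<open>A j\<close> forbids a return to \<open>I j\<close> within \<open>N\<close>
    steps.\<close>
  have C_disj: False if x: "x \<in> C" "(T ^^ k) x \<in> C" and k: "k \<in> {1..N}" for x k
  proof -
    have xs: "x \<in> space MX" using x by (simp add: C_def)
    obtain i j where i: "x \<in> A i" "\<forall>l<i. x \<notin> V l" and j: "(T ^^ k) x \<in> A j" "\<forall>l<j. (T ^^ k) x \<notin> V l"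
      using x by (auto simp: C_def)
    have "x \<in> V i" using i(1) AV by blast
    then have "\<not> i < j" using j(2) V_Tn[OF xs] by auto
    moreover have "x \<in> V j" using subsetD[OF AV j(1)] V_Tn[OF xs] by simp
    then have "\<not> j < i" using i(2) by auto
    ultimately have "i = j" by simp
    then show False using i j k by (auto simp: A_def)
  qed
  have C_small: "measure MX C < e"
  proof -
    let ?D = "\<lambda>k. (T ^^ k) -` C \<inter> space MX"
    have D: "?D k \<in> sets MX" for k by measurable
    \<comment> \<open>Seen from time \<open>k\<close>, a common point would return to
      \<open>C\<close> after \<open>l - k\<close> steps.\<close>
    have disj: False if "x \<in> ?D k" "x \<in> ?D l" "k < l" "l \<le> N" for x k l
    proof (rule C_disj)
      show "(T ^^ k) x \<in> C" using that by auto
      have "(T ^^ (l - k)) ((T ^^ k) x) = (T ^^ l) x"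
        using that(3) funpow_add[of "l - k" k T] by simp
      then show "(T ^^ (l - k)) ((T ^^ k) x) \<in> C" using that by auto
      show "l - k \<in> {1..N}" using that by auto
    qed
    have "disjoint_family_on ?D {..N}"
      unfolding disjoint_family_on_def
    proof (intro ballI impI)
      fix k l assume kl: "k \<in> {..N}" "l \<in> {..N}" "k \<noteq> l"
      show "?D k \<inter> ?D l = {}"
      proof (rule ccontr)
        assume "?D k \<inter> ?D l \<noteq> {}"
        then obtain x where "x \<in> ?D k" "x \<in> ?D l" by blast
        then show False using disj[of x k l] disj[of x l k] kl by (cases "k < l") auto
      qed
    qed
    then have "measure MX (\<Union>k\<in>{..N}. ?D k) = (\<Sum>k\<in>{..N}. measure MX (?D k))"
      using D by (intro X.finite_measure_finite_Union) auto
    also have "\<dots> = (\<Sum>k\<in>{..N}. measure MX C)"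
      using inv_mpt_measure_vimage[OF inv_mpt_funpow[OF T] C] by simp
    finally have "real (Suc N) * measure MX C \<le> 1"
      using X.prob_le_1[of "\<Union>k\<in>{..N}. ?D k"] by simp
    then have "measure MX C \<le> inverse (real (Suc N))"
      by (simp add: field_simps)
    then show ?thesis using N by simp
  qed

  define P where "P = {x \<in> space MX. \<exists>n>0. (T ^^ n) x = x}"
  have P [measurable]: "P \<in> sets MX" unfolding P_def by measurable
  have visit: "\<exists>n. (T ^^ n) x \<in> C \<or> (T' ^^ n) x \<in> C" if x: "x \<in> space MX - P" for x
  proof -
    have xs: "x \<in> space MX" using x by auto
    \<comment> \<open>An aperiodic \<open>x\<close> differs from its next \<open>N\<close> iterates,
      so some interval of the list separates it from them.\<close>
    have nin: "x \<notin> (\<lambda>k. (T ^^ k) x) ` {1..N}"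
    proof
      assume "x \<in> (\<lambda>k. (T ^^ k) x) ` {1..N}"
      then obtain k where k: "x = (T ^^ k) x" "k \<in> {1..N}" by (rule imageE)
      have "k > 0" using k(2) by simp
      then show False using x k(1)[symmetric] unfolding P_def by blast
    qed
    have fin: "finite ((\<lambda>k. (T ^^ k) x) ` {1..N})" by (intro finite_imageI finite_atLeastAtMost)
    obtain p q :: rat where pq: "x \<in> {of_rat p<..<of_rat q}"
      "{of_rat p<..<of_rat q} \<inter> (\<lambda>k. (T ^^ k) x) ` {1..N} = {}"
      using exists_rational_interval[OF fin nin] by blast
    have "I (to_nat (p, q)) = {of_rat p<..<of_rat q}" by (simp add: I_def)
    then have "x \<in> A (to_nat (p, q))"
      using pq xs unfolding A_def by blast
    then have ex: "\<exists>j. x \<in> V j" using AV by blast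
    define j where "j = (LEAST j. x \<in> V j)"
    have j: "x \<in> V j" "\<And>i. i < j \<Longrightarrow> x \<notin> V i"
      unfolding j_def using LeastI_ex[OF ex] not_less_Least by blast+
    then obtain n where n: "(T ^^ n) x \<in> A j \<or> (T' ^^ n) x \<in> A j" by (auto simp: V_def)
    moreover have "\<forall>i<j. (T ^^ n) x \<notin> V i \<and> (T' ^^ n) x \<notin> V i"
      using j(2) by (simp add: V_Tn[OF xs] V_T'n[OF xs])
    ultimately have "(T ^^ n) x \<in> C \<or> (T' ^^ n) x \<in> C"
      unfolding C_def using sp[OF xs] by blast
    then show ?thesis ..
  qed

  define U where "U = {x \<in> space MX. \<exists>n. (T' ^^ Suc n) x \<in> C}"
  have U [measurable]: "U \<in> sets MX" unfolding U_def by measurable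
  have U_T: "T x \<in> U" if "x \<in> U" for x
  proof -
    obtain n where n: "x \<in> space MX" "(T' ^^ Suc n) x \<in> C" using \<open>x \<in> U\<close> by (auto simp: U_def)
    then have "(T' ^^ Suc (Suc n)) (T x) \<in> C"
      using T'T[of x] by (simp only: funpow_Suc_right o_apply)
    then show ?thesis using sp1[OF n(1)] unfolding U_def by blast
  qed
  \<comment> \<open>Recurrence: the preimages of \<open>U\<close> increase because \<open>T\<close>
    maps \<open>U\<close> into itself, yet all have the measure of \<open>U\<close>. Their union
    contains every aperiodic point and has no larger measure, so \<open>U\<close> has full
    measure.\<close>
  let ?W = "\<lambda>k. (T ^^ k) -` U \<inter> space MX"
  have "incseq ?W" by (rule incseq_SucI) (use U_T in auto)
  then have "(\<lambda>k. measure MX (?W k)) \<longlonglongrightarrow> measure MX (\<Union>k. ?W k)"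
    by (intro X.finite_Lim_measure_incseq) auto
  then have "measure MX (\<Union>k. ?W k) = measure MX U"
    using inv_mpt_measure_vimage[OF inv_mpt_funpow[OF T] U] by (simp add: LIMSEQ_const_iff)
  \<comment> \<open>Moving a point far enough forward puts any visit to \<open>C\<close> into its
    strict past.\<close>
  moreover have "space MX - P \<subseteq> (\<Union>k. ?W k)"
  proof
    fix x assume x: "x \<in> space MX - P"
    then have xs: "x \<in> space MX" by simp
    obtain n where "(T ^^ n) x \<in> C \<or> (T' ^^ n) x \<in> C" using visit[OF x] by blast
    then have "(T ^^ Suc n) x \<in> U \<or> T x \<in> U"
    proof
      assume "(T ^^ n) x \<in> C"
      then have "(T' ^^ Suc 0) ((T ^^ Suc n) x) \<in> C" using T'T[OF sp(1)[OF xs]] by simp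
      then show ?thesis using sp(1)[OF xs] unfolding U_def by blast
    next
      assume "(T' ^^ n) x \<in> C"
      then have "(T' ^^ Suc n) (T x) \<in> C" using T'T[OF xs] by (simp only: funpow_Suc_right o_apply)
      then show ?thesis using sp1[OF xs] unfolding U_def by blast
    qed
    then have "x \<in> ?W (Suc n) \<or> x \<in> ?W 1" using xs by auto
    then show "x \<in> (\<Union>k. ?W k)" by blast
  qed
  then have "measure MX (space MX - P) \<le> measure MX (\<Union>k. ?W k)"
    by (intro X.finite_measure_mono) auto
  moreover have "measure MX (space MX - P) = 1"
    using \<open>antiperiodic T\<close> X.prob_compl[OF P] by (simp add: antiperiodic_def P_def)
  ultimately have "measure MX (space MX - U) = 0"
    using X.prob_compl[OF U] X.prob_le_1[of U] by simp
  then have "measure MX (C \<union> (space MX - U)) < e"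
    using measure_Un_le[of C MX "space MX - U"] C_small by simp
  moreover have "\<exists>n. (T' ^^ Suc n) x \<in> C \<union> (space MX - U)" if x: "x \<in> space MX" for x
  proof (cases "x \<in> U")
    case False
    have "T (T' x) = x" unfolding T'_def using T x by (rule inv_mptD)
    then have "T' x \<notin> U" using False U_T[of "T' x"] by auto
    then show ?thesis using sp1[OF x] by (intro exI[of _ 0]) simp
  qed (auto simp: U_def)
  ultimately show ?thesis by (intro bexI[of _ "C \<union> (space MX - U)"]) auto
qed

section \<open>Conjugates of the trivial extension\<close>

lemma funpow_times_id:
  fixes T0 :: "'a \<Rightarrow> 'a"
  shows "((\<lambda>(x, y). (T0 x, y)) ^^ n) (x, y) = ((T0 ^^ n) x, y)"
  by (induction n) auto

text \<open>
  Towers stand on \<open>T0 ` C\<close>: the last visit of \<open>x\<close> to \<open>C\<close> before time \<open>0\<close> is \<open>N x + 1\<close> steps back, so \<open>N x\<close> is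
  the height of \<open>x\<close>. The fibre map \<open>S\<close> undoes \<open>T\<close> down to the base of the tower.
\<close>

lemma ext_set_conjugate_off_small_set:
  assumes T0: "T0 \<in> inv_mpt MX" and "antiperiodic T0" and T: "T \<in> ext_set T0" and "e > 0"
  shows "\<exists>S\<in>ext_set id. \<exists>C\<in>sets MX. measure MX C < e \<and>
    (\<forall>z\<in>space MZ. fst z \<notin> C \<longrightarrow> S (T z) = (case S z of (x, y) \<Rightarrow> (T0 x, y)))"
proof -
  let ?P = "\<lambda>(x, y). (T0 x, y)"
  let ?T0' = "the_inv_into (space MX) T0" and ?T' = "the_inv_into (space MZ) T"
  note T_inv = ext_setD(1)[OF T]
  obtain C where C [measurable]: "C \<in> sets MX" "measure MX C < e"
    and sweep: "\<And>x. x \<in> space MX \<Longrightarrow> \<exists>n. (?T0' ^^ Suc n) x \<in> C"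
    using sweeping_set[OF assms(1,2,4)] by blast
  define N where "N x = (LEAST n. (?T0' ^^ Suc n) x \<in> C)" for x
  have [measurable]: "?T0' ^^ n \<in> MX \<rightarrow>\<^sub>M MX" for n
    by (rule inv_mptD(2)[OF inv_mpt_funpow[OF inv_mpt_the_inv_into[OF T0]]])
  have N_meas: "N \<in> MX \<rightarrow>\<^sub>M count_space UNIV"
    unfolding N_def by measurable
  \<comment> \<open>\<open>F n\<close> descends \<open>n\<close> levels by the inverse of
    \<open>T\<close> and climbs back by \<open>T0 \<times> id\<close>, so it lies over the identity
    of the base.\<close>
  define F where "F n = (?P ^^ n) \<circ> (?T' ^^ n)" for n
  have F: "F n \<in> ext_set id" for n
  proof -
    have "F n \<in> ext_set ((T0 ^^ n) \<circ> (?T0' ^^ n))"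
      unfolding F_def
      by (intro ext_set_comp ext_set_funpow ext_set_times_id ext_set_the_inv_into T T0)
    then show ?thesis
      by (rule ext_set_cong) (simp add: funpow_the_inv_into(2)[OF T0])
  qed
  have "F (N (fst (T z))) (T z) = ?P (F (N (fst z)) z)" if z: "z \<in> space MZ" "fst z \<notin> C" for z
  proof -
    let ?x = "fst z"
    have x: "?x \<in> space MX" using z by (auto simp: space_MZ)
    have T0'T0: "?T0' (T0 ?x) = ?x" using T0 x by (rule inv_mptD)
    obtain n where n: "(?T0' ^^ Suc n) (T0 ?x) \<in> C"
      using sweep[OF inv_mptD(5)[OF T0 x]] by blast
    \<comment> \<open>One step back from \<open>T0 ?x\<close> is \<open>?x\<close>, which lies
      outside \<open>C\<close>; the search for the last visit continues from \<open>?x\<close>, and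
      the height grows by one.\<close>
    have "N (T0 ?x) = Suc (N ?x)"
      unfolding N_def
    proof (subst Least_Suc)
      show "(?T0' ^^ Suc n) (T0 ?x) \<in> C" by (rule n)
      show "\<not> (?T0' ^^ Suc 0) (T0 ?x) \<in> C" using T0'T0 z(2) by simp
      show "Suc (LEAST m. (?T0' ^^ Suc (Suc m)) (T0 ?x) \<in> C) = Suc (LEAST n. (?T0' ^^ Suc n) ?x \<in> C)"
        by (simp only: funpow_Suc_right o_apply T0'T0)
    qed
    \<comment> \<open>The innermost inverse cancels \<open>T\<close>, and one further
      \<open>?P\<close> remains outside.\<close>
    moreover have "F (Suc n) (T z) = ?P (F n z)" for n
      using inv_mptD(7)[OF T_inv z(1)]
      unfolding F_def funpow.simps(2)[of n ?P] funpow_Suc_right[of n ?T'] by simp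
    ultimately show ?thesis using ext_setD(2)[OF T z(1)] by simp
  qed
  then show ?thesis
    using ext_set_piecewise[OF N_meas F] C by (intro bexI[of _ "\<lambda>z. F (N (fst z)) z"] bexI[of _ C]) auto
qed

lemma measure_MZ_rect:
  assumes "A \<in> sets MX" "B \<in> sets MX"
  shows "measure MZ (A \<times> B) = measure MX A * measure MX B"
  using X.emeasure_pair_measure_Times[OF assms] by (simp add: MZ_def measure_def enn2real_mult)

text \<open>Off the strip over \<open>C\<close> the conjugate equals \<open>T\<close>, so the images
  of any \<open>E\<close> differ only inside the two images of that strip. Their total measure is at
  most \<open>2 * measure MX C\<close>, whence \<open>e / 2\<close> and a bound independent of
  \<open>E\<close>.\<close>

lemma ext_set_conjugate_near:
  assumes T0: "T0 \<in> inv_mpt MX" and "antiperiodic T0" and T: "T \<in> ext_set T0" and "e > 0"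
  shows "\<exists>S\<in>ext_set id. the_inv_into (space MZ) S \<circ> (\<lambda>(x, y). (T0 x, y)) \<circ> S \<in> ext_set T0 \<and>
    (\<forall>E\<in>sets MZ. measure MZ (sym_diff
      ((the_inv_into (space MZ) S \<circ> (\<lambda>(x, y). (T0 x, y)) \<circ> S) ` E) (T ` E)) < e)"
proof -
  let ?P = "\<lambda>(x, y). (T0 x, y)"
  have "e / 2 > 0" using \<open>e > 0\<close> by simp
  from ext_set_conjugate_off_small_set[OF T0 assms(2) T this]
  obtain S C where S: "S \<in> ext_set id" and C [measurable]: "C \<in> sets MX" "measure MX C < e / 2"
    and ST: "\<And>z. z \<in> space MZ \<Longrightarrow> fst z \<notin> C \<Longrightarrow> S (T z) = ?P (S z)"
    by auto
  define R where "R = the_inv_into (space MZ) S \<circ> ?P \<circ> S"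
  have "R \<in> ext_set (the_inv_into (space MX) id \<circ> T0 \<circ> id)"
    unfolding R_def
    by (intro ext_set_comp ext_set_the_inv_into ext_set_times_id S T0 inv_mpt_id)
  then have R: "R \<in> ext_set T0"
    by (rule ext_set_cong) (use inv_mptD(7)[OF inv_mpt_id, of _ MX] inv_mptD(5)[OF T0] in simp)
  have eq: "R z = T z" if "z \<in> space MZ" "fst z \<notin> C" for z
    using ST[OF that] inv_mptD(7)[OF ext_setD(1)[OF S], of "T z"]
      inv_mptD(5)[OF ext_setD(1)[OF T] that(1)] by (simp add: R_def)
  let ?C = "C \<times> space MX"
  have C': "?C \<in> sets MZ" by (simp add: MZ_def)
  have "measure MZ (sym_diff (R ` E) (T ` E)) < e" if E: "E \<in> sets MZ" for E
  proof -
    note im = inv_mpt_image[OF ext_setD(1)[OF R]] inv_mpt_image[OF ext_setD(1)[OF T]]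
    have "E \<subseteq> space MZ" using E by (rule sets.sets_into_space)
    have "R z \<in> T ` E \<union> R ` ?C" "T z \<in> R ` E \<union> T ` ?C" if "z \<in> E" for z
    proof -
      have z: "z \<in> space MZ" using that \<open>E \<subseteq> space MZ\<close> by blast
      show "R z \<in> T ` E \<union> R ` ?C" "T z \<in> R ` E \<union> T ` ?C"
      proof (atomize(full), cases "fst z \<in> C")
        case True
        then have "z \<in> ?C" using z by (auto simp: space_MZ)
        then show "R z \<in> T ` E \<union> R ` ?C \<and> T z \<in> R ` E \<union> T ` ?C" by blast
      next
        case False
        then show "R z \<in> T ` E \<union> R ` ?C \<and> T z \<in> R ` E \<union> T ` ?C"
          using eq[OF z] that imageI[of z E R] imageI[of z E T] by simp
      qed
    qed
    then have "sym_diff (R ` E) (T ` E) \<subseteq> R ` ?C \<union> T ` ?C" by blast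
    then have "measure MZ (sym_diff (R ` E) (T ` E)) \<le> measure MZ (R ` ?C \<union> T ` ?C)"
      using im C' E by (intro Z.finite_measure_mono) auto
    also have "\<dots> \<le> measure MZ (R ` ?C) + measure MZ (T ` ?C)"
      using im C' by (intro measure_Un_le) auto
    also have "\<dots> = 2 * measure MX C"
      using im C' measure_MZ_rect[OF C(1) sets.top] by (simp add: X.prob_space)
    finally show ?thesis using C(2) by simp
  qed
  then show ?thesis using S R unfolding R_def by blast
qed

text \<open>\<open>T0 \<times> id\<close> moves points along horizontal slices only. Each slice of
  \<open>D\<close> returns by rigidity of \<open>T0\<close>, and dominated convergence integrates
  over the height \<open>y\<close>. The times are fixed before \<open>D\<close> is chosen.\<close>

lemma rigid_return_times_id:
  assumes T0: "T0 \<in> inv_mpt MX" and "rigid T0"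
  shows "\<exists>nk :: nat \<Rightarrow> nat. strict_mono nk \<and> (\<forall>D\<in>sets MZ.
    (\<lambda>k. measure MZ (D \<inter> (((\<lambda>(x, y). (T0 x, y)) ^^ nk k) -` D \<inter> space MZ))) \<longlonglongrightarrow> measure MZ D)"
proof -
  let ?P = "\<lambda>(x, y). (T0 x, y)"
  obtain nk :: "nat \<Rightarrow> nat" where nk: "strict_mono nk"
    and lim: "\<And>f. f \<in> L2 MX \<Longrightarrow>
      (\<lambda>k. sqrt (\<integral>x. (cmod (f ((T0 ^^ nk k) x) - f x))\<^sup>2 \<partial>MX)) \<longlonglongrightarrow> 0"
    using \<open>rigid T0\<close> unfolding rigid_def by blast
  have [measurable]: "T0 ^^ n \<in> MX \<rightarrow>\<^sub>M MX" for n
    by (rule inv_mptD(2)[OF inv_mpt_funpow[OF T0]])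
  have P_inv: "?P ^^ n \<in> inv_mpt MZ" for n
    by (rule inv_mpt_funpow[OF ext_setD(1)[OF ext_set_times_id[OF T0]]])
  have return: "(\<lambda>k. measure MZ (D \<inter> ((?P ^^ nk k) -` D \<inter> space MZ))) \<longlonglongrightarrow> measure MZ D"
    if D: "D \<in> sets MZ" for D
  proof -
    \<comment> \<open>The part of \<open>D\<close> that is outside \<open>D\<close> at time
      \<open>n\<close>; its measure has to vanish along the rigidity times.\<close>
    define B where "B n = D - ((?P ^^ n) -` D \<inter> space MZ)" for n
    have pre: "(?P ^^ n) -` D \<inter> space MZ \<in> sets MZ" for n
      using inv_mptD(2)[OF P_inv] D by (rule measurable_sets)
    have B: "B n \<in> sets MZ" for n unfolding B_def using D pre by auto
    let ?sl = "\<lambda>E y. (\<lambda>x. (x, y)) -` E"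
    define g where "g n y = measure MX (?sl (B n) y)" for n y
    have g_ennreal: "ennreal (g n y) = emeasure MX (?sl (B n) y)" for n y
      by (simp add: g_def X.emeasure_eq_measure)
    have g_meas [measurable]: "g n \<in> borel_measurable MX" for n
    proof -
      have "(\<lambda>y. emeasure MX (?sl (B n) y)) \<in> borel_measurable MX"
        using B unfolding MZ_def by (rule XX.measurable_emeasure_Pair2)
      then show ?thesis unfolding g_def measure_def by measurable
    qed
    have slice: "(\<lambda>k. g (nk k) y) \<longlonglongrightarrow> 0" if y: "y \<in> space MX" for y
    proof -
      let ?Dy = "?sl D y"
      have Dy [measurable]: "?Dy \<in> sets MX"
        using D unfolding MZ_def by (rule sets_Pair2)
      let ?f = "indicator ?Dy :: real \<Rightarrow> complex"
      have "?f \<in> L2 MX"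
        unfolding L2_def
      proof (intro CollectI conjI)
        show "integrable MX (\<lambda>x. (cmod (?f x))\<^sup>2)"
          by (rule X.integrable_const_bound[of _ 1]) (auto split: split_indicator)
      qed measurable
      then have "(\<lambda>k. (sqrt (\<integral>x. (cmod (?f ((T0 ^^ nk k) x) - ?f x))\<^sup>2 \<partial>MX))\<^sup>2) \<longlonglongrightarrow> 0\<^sup>2"
        by (intro tendsto_power lim)
      then have sq: "(\<lambda>k. \<integral>x. (cmod (?f ((T0 ^^ nk k) x) - ?f x))\<^sup>2 \<partial>MX) \<longlonglongrightarrow> 0"
        by (simp add: integral_nonneg_AE)
      \<comment> \<open>On the slice of \<open>B n\<close> the two indicators take the values 0 and
        1, so the integrand is 1 there.\<close>
      have le: "g n y \<le> (\<integral>x. (cmod (?f ((T0 ^^ n) x) - ?f x))\<^sup>2 \<partial>MX)" for n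
      proof -
        have sB [measurable]: "?sl (B n) y \<in> sets MX"
          using B unfolding MZ_def by (rule sets_Pair2)
        have "g n y = (\<integral>x. indicator (?sl (B n) y) x \<partial>MX)"
          using sets.sets_into_space[OF sB] by (simp add: g_def Int_absorb2)
        also have "\<dots> \<le> (\<integral>x. (cmod (?f ((T0 ^^ n) x) - ?f x))\<^sup>2 \<partial>MX)"
        proof (rule integral_mono)
          show "integrable MX (indicator (?sl (B n) y) :: real \<Rightarrow> real)"
            by (rule X.integrable_const_bound[of _ 1]) (auto split: split_indicator)
          show "integrable MX (\<lambda>x. (cmod (?f ((T0 ^^ n) x) - ?f x))\<^sup>2)"
            by (rule X.integrable_const_bound[of _ 1]) (auto split: split_indicator)
          show "indicator (?sl (B n) y) x \<le> (cmod (?f ((T0 ^^ n) x) - ?f x))\<^sup>2"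
            if "x \<in> space MX" for x
            using that y by (auto simp: indicator_def B_def funpow_times_id space_MZ)
        qed
        finally show ?thesis .
      qed
      show ?thesis
      proof (rule tendsto_sandwich[OF _ _ tendsto_const sq])
        show "eventually (\<lambda>k. 0 \<le> g (nk k) y) sequentially" by (simp add: g_def)
      qed (simp add: le)
    qed
    have "(\<lambda>k. \<integral>\<^sup>+y. norm (0 - g (nk k) y) \<partial>MX) \<longlonglongrightarrow> 0"
    proof (rule nn_integral_dominated_convergence_norm[where w = "\<lambda>_. 1"])
      show "AE y in MX. (\<lambda>k. g (nk k) y) \<longlonglongrightarrow> 0" using slice by (intro AE_I2)
      show "AE y in MX. norm (g (nk j) y) \<le> 1" for j by (simp add: g_def X.prob_le_1)
    qed (auto simp: X.emeasure_space_1)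
    moreover have "(\<integral>\<^sup>+y. norm (0 - g n y) \<partial>MX) = ennreal (measure MZ (B n))" for n
    proof -
      have "(\<integral>\<^sup>+y. norm (0 - g n y) \<partial>MX) = (\<integral>\<^sup>+y. emeasure MX (?sl (B n) y) \<partial>MX)"
        by (simp add: g_ennreal[symmetric] g_def)
      also have "\<dots> = emeasure MZ (B n)"
        using B unfolding MZ_def by (rule XX.emeasure_pair_measure_alt2[symmetric])
      finally show ?thesis by (simp add: Z.emeasure_eq_measure)
    qed
    ultimately have "(\<lambda>k. measure MZ (B (nk k))) \<longlonglongrightarrow> 0"
      by (simp add: tendsto_ennreal_iff[of _ _ 0, simplified])
    then have "(\<lambda>k. measure MZ D - measure MZ (B (nk k))) \<longlonglongrightarrow> measure MZ D - 0"
      by (intro tendsto_diff tendsto_const)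
    moreover have "measure MZ D - measure MZ (B n) = measure MZ (D \<inter> ((?P ^^ n) -` D \<inter> space MZ))" for n
      using Z.finite_measure_Diff'[OF D pre[of n]] by (simp add: B_def)
    ultimately show ?thesis by simp
  qed
  with nk show ?thesis by blast
qed

section \<open>Returns of strongly mixing extensions\<close>

lemma subalgebra_FX: "subalgebra MZ FX"
proof -
  have "sets FX \<subseteq> sets MZ"
    unfolding FX_def
  proof (subst sets_vimage_algebra2)
    show "fst \<in> space MZ \<rightarrow> space MX" by (auto simp: space_MZ)
    show "{fst -` A \<inter> space MZ |A. A \<in> sets MX} \<subseteq> sets MZ"
      by (auto intro: measurable_sets[OF measurable_fst_MZ])
  qed
  then show ?thesis by (simp add: subalgebra_def FX_def)
qed

interpretation FX: sigma_finite_subalgebra MZ FX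
  by (intro finite_measure_subalgebra_is_sigma_finite finite_measure_subalgebra.intro
      finite_measure_subalgebra_axioms.intro Z.finite_measure_axioms subalgebra_FX)

text \<open>The test set is independent of the base, with measure 1/2 in every fibre: mixing
  predicts an overlap of 1/4, rigidity one of 1/2.\<close>

definition half :: "(real \<times> real) set" where
  "half = space MX \<times> {0..1/2}"

lemma sets_lower_half: "{0..1/2} \<in> sets MX"
  by (auto simp: MX_def sets_restrict_space_iff)

lemma measure_lower_half: "measure MX {0..1/2} = 1/2"
  unfolding MX_def by (subst measure_restrict_space) auto

lemma sets_half [measurable]: "half \<in> sets MZ"
  using sets_lower_half by (simp add: half_def MZ_def)

lemma half_subset: "half \<subseteq> space MZ"
  by (rule sets.sets_into_space[OF sets_half])

lemma measure_half: "measure MZ half = 1/2"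
  unfolding half_def
  using measure_MZ_rect[OF sets.top sets_lower_half] measure_lower_half by (simp add: X.prob_space)

lemma integrable_indicator_MZ: "K \<in> sets MZ \<Longrightarrow> integrable MZ (indicator K :: _ \<Rightarrow> real)"
  by (rule Z.integrable_const_bound[of _ 1]) (auto split: split_indicator)

text \<open>The sets of \<open>FX\<close> are the strips \<open>B \<times> space MX\<close>, and
  \<open>half\<close> fills half of each, so the constant 1/2 has the characterizing
  integrals.\<close>

lemma real_cond_exp_half: "AE z in MZ. real_cond_exp MZ FX (indicator half) z = 1/2"
proof (rule FX.real_cond_exp_charact)
  fix A assume "A \<in> sets FX"
  then obtain B where B: "B \<in> sets MX" "A = fst -` B \<inter> space MZ"
    unfolding FX_def by (subst (asm) sets_vimage_algebra2) (auto simp: space_MZ)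
  then have A: "A = B \<times> space MX"
    using sets.sets_into_space[OF B(1)] by (auto simp: space_MZ)
  then have AZ: "A \<in> sets MZ" using B(1) by (simp add: MZ_def)
  have "A \<inter> half = B \<times> {0..1/2}"
    using A sets.sets_into_space[OF B(1)] sets.sets_into_space[OF sets_lower_half] by (auto simp: half_def)
  then have AH: "measure MZ (A \<inter> half) = measure MX B * (1/2)"
    using measure_MZ_rect[OF B(1) sets_lower_half] measure_lower_half by simp
  have "(\<integral>x\<in>A. indicator half x \<partial>MZ) = (\<integral>x. indicator (A \<inter> half) x \<partial>MZ)"
    unfolding set_lebesgue_integral_def by (intro Bochner_Integration.integral_cong) (auto split: split_indicator)
  also have "\<dots> = measure MX B * (1/2)"
    using sets.sets_into_space[OF AZ] AH by (simp add: Int_absorb2 inf.coboundedI1)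
  also have "\<dots> = (\<integral>x\<in>A. (1/2::real) \<partial>MZ)"
    using measure_MZ_rect[OF B(1) sets.top] AZ A Z.emeasure_finite[of A]
    by (simp add: set_integral_const X.prob_space)
  finally show "(\<integral>x\<in>A. indicator half x \<partial>MZ) = (\<integral>x\<in>A. (1/2::real) \<partial>MZ)" .
qed (auto intro: integrable_indicator_MZ)

lemma real_cond_exp_indicator_bounds:
  assumes "K \<in> sets MZ"
  shows "AE z in MZ. 0 \<le> real_cond_exp MZ FX (indicator K) z \<and> real_cond_exp MZ FX (indicator K) z \<le> 1"
  using FX.real_cond_exp_ge_c[OF integrable_indicator_MZ[OF assms], of 0]
    FX.real_cond_exp_le_c[OF integrable_indicator_MZ[OF assms], of 1]
  by (auto split: split_indicator)

lemma half_in_L2_rel: "indicator half \<in> L2_rel"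
proof -
  have sq: "(\<lambda>w. (cmod (indicator half w))\<^sup>2) = (indicator half :: _ \<Rightarrow> real)"
    by (auto split: split_indicator)
  have "AE z in MZ. sqrt (real_cond_exp MZ FX (indicator half) z) \<le> 1"
    using real_cond_exp_indicator_bounds[OF sets_half] by auto
  moreover have "(indicator half :: _ \<Rightarrow> complex) \<in> borel_measurable MZ" by measurable
  ultimately show ?thesis
    unfolding L2_rel_def L2_def using integrable_indicator_MZ[OF sets_half] sq by (auto intro!: exI[of _ 1])
qed

text \<open>Nonnegativity of the variance. It turns the L2 distance in the mixing condition into a
  bound on plain expectations.\<close>

lemma (in prob_space) abs_expectation_le_sqrt:
  fixes f :: "'a \<Rightarrow> real"
  assumes "integrable M f" "integrable M (\<lambda>x. (f x)\<^sup>2)"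
  shows "\<bar>expectation f\<bar> \<le> sqrt (expectation (\<lambda>x. (f x)\<^sup>2))"
proof -
  have "(expectation f)\<^sup>2 \<le> expectation (\<lambda>x. (f x)\<^sup>2)"
    using variance_eq[OF assms] variance_positive[of f] by simp
  then show ?thesis by (simp add: real_le_rsqrt)
qed

text \<open>With both functions the indicator of \<open>half\<close>, the correlation term is the
  conditional measure of the return set and the product term is the constant 1/4; integrating
  removes the conditioning.\<close>

lemma strongly_mixing_return:
  assumes T0: "T0 \<in> inv_mpt MX" and mix: "strongly_mixing_ext T0 T"
  shows "(\<lambda>n. measure MZ ((T ^^ n) ` half \<inter> half)) \<longlonglongrightarrow> 1/4"
proof -
  let ?P = "\<lambda>(x, y). (T0 x, y)"
  let ?h = "indicator half :: real \<times> real \<Rightarrow> complex"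
  have T: "T \<in> inv_mpt MZ"
    using mix ext_setD(1) unfolding strongly_mixing_ext_def by blast
  define u where "u n z = (cmod (cond_X (\<lambda>w. ?h ((T ^^ n) w) * cnj (?h w)) z
      - cond_X ?h ((T0 ^^ n) (fst z), snd z) * cond_X (\<lambda>w. cnj (?h w)) z))\<^sup>2" for n z
  have lim: "(\<lambda>n. sqrt (\<integral>z. u n z \<partial>MZ)) \<longlonglongrightarrow> 0"
    unfolding u_def using mix half_in_L2_rel unfolding strongly_mixing_ext_def by blast
  define K where "K n = half \<inter> ((T ^^ n) -` half \<inter> space MZ)" for n
  have Tn: "T ^^ n \<in> inv_mpt MZ" for n by (rule inv_mpt_funpow[OF T])
  have K [measurable]: "K n \<in> sets MZ" for n
    unfolding K_def using inv_mptD(2)[OF Tn] sets_half by (intro sets.Int measurable_sets)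
  define r where "r n = real_cond_exp MZ FX (indicator (K n))" for n
  have r_meas [measurable]: "r n \<in> borel_measurable MZ" for n
    unfolding r_def by simp
  have zero: "AE z in MZ. real_cond_exp MZ FX (\<lambda>_. 0) z = 0"
    by (rule FX.real_cond_exp_F_meas) auto
  have Re_Im: "(\<lambda>w. Re (?h ((T ^^ n) w) * cnj (?h w))) = indicator (K n)"
    "(\<lambda>w. Im (?h ((T ^^ n) w) * cnj (?h w))) = (\<lambda>_. 0)"
    "(\<lambda>w. Re (?h w)) = indicator half" "(\<lambda>w. Im (?h w)) = (\<lambda>_. 0)"
    "(\<lambda>w. Re (cnj (?h w))) = indicator half" "(\<lambda>w. Im (cnj (?h w))) = (\<lambda>_. 0)" for n
    using half_subset by (auto simp: K_def fun_eq_iff split: split_indicator)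
  have Pn: "?P ^^ n \<in> inv_mpt MZ" for n
    by (rule inv_mpt_funpow[OF ext_setD(1)[OF ext_set_times_id[OF T0]]])
  have Pn_eq: "((T0 ^^ n) (fst z), snd z) = (?P ^^ n) z" for n z
    by (cases z) (simp add: funpow_times_id)
  \<comment> \<open>The mixing condition evaluates \<open>cond_X ?h\<close> along
    \<open>T0 ^^ n\<close>, so identities that hold almost everywhere must be carried along the
    measure-preserving map \<open>?P ^^ n\<close>.\<close>
  have shift: "AE z in MZ. Q ((?P ^^ n) z)" if "AE z in MZ. Q z" for Q n
  proof (rule AE_distrD[OF inv_mptD(2)[OF Pn]])
    show "AE z in distr MZ MZ (?P ^^ n). Q z" using that by (simp only: inv_mptD(3)[OF Pn])
  qed
  have u_eq: "AE z in MZ. u n z = (r n z - 1/4)\<^sup>2" for n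
    using zero real_cond_exp_half shift[OF zero, of n] shift[OF real_cond_exp_half, of n]
  proof eventually_elim
    case (elim z)
    have eqs: "cond_X (\<lambda>w. ?h ((T ^^ n) w) * cnj (?h w)) z = of_real (r n z)"
      "cond_X ?h ((T0 ^^ n) (fst z), snd z) = of_real (1/2)"
      "cond_X (\<lambda>w. cnj (?h w)) z = of_real (1/2)"
      unfolding cond_X_def Re_Im Pn_eq r_def elim by simp_all
    have "u n z = (cmod (of_real (r n z - 1/4)))\<^sup>2"
      unfolding u_def eqs by simp
    then show ?case by (simp only: norm_of_real power2_abs)
  qed
  have u_meas: "u n \<in> borel_measurable MZ" for n
  proof -
    have [measurable]: "?P ^^ n \<in> MZ \<rightarrow>\<^sub>M MZ" using Pn by (rule inv_mptD)
    show ?thesis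
      unfolding u_def cond_X_def Re_Im Pn_eq by measurable
  qed
  have bound: "\<bar>measure MZ (K n) - 1/4\<bar> \<le> sqrt (\<integral>z. u n z \<partial>MZ)" for n
  proof -
    have int: "integrable MZ (r n)" "(\<integral>z. r n z \<partial>MZ) = measure MZ (K n)"
      using FX.real_cond_exp_int[OF integrable_indicator_MZ[OF K[of n]]] sets.sets_into_space[OF K[of n]]
      by (simp_all add: r_def Int_absorb2)
    have "AE z in MZ. norm ((r n z - 1/4)\<^sup>2) \<le> 1"
      using real_cond_exp_indicator_bounds[OF K[of n]]
    proof eventually_elim
      case (elim z)
      then have "\<bar>r n z - 1/4\<bar> \<le> 1" by (simp add: r_def abs_le_iff)
      then have "\<bar>r n z - 1/4\<bar>\<^sup>2 \<le> 1" by (intro power_le_one) auto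
      then show ?case by simp
    qed
    then have sq: "integrable MZ (\<lambda>z. (r n z - 1/4)\<^sup>2)"
      by (intro Z.integrable_const_bound[of _ 1]) auto
    have "measure MZ (K n) - 1/4 = (\<integral>z. r n z - 1/4 \<partial>MZ)"
      using int by (simp add: Z.prob_space)
    also have "\<bar>\<dots>\<bar> \<le> sqrt (\<integral>z. (r n z - 1/4)\<^sup>2 \<partial>MZ)"
      using int(1) sq by (intro Z.abs_expectation_le_sqrt) auto
    also have "(\<integral>z. (r n z - 1/4)\<^sup>2 \<partial>MZ) = (\<integral>z. u n z \<partial>MZ)"
      using u_eq[of n] u_meas[of n] by (intro integral_cong_AE) auto
    finally show ?thesis .
  qed
  have "(\<lambda>n. measure MZ (K n) - 1/4) \<longlonglongrightarrow> 0"
    by (rule Lim_null_comparison[OF _ lim]) (simp add: bound)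
  then have "(\<lambda>n. measure MZ (K n)) \<longlonglongrightarrow> 1/4"
    by (simp add: LIM_zero_iff)
  then show ?thesis
    using inv_mpt_measure_image_Int[OF Tn sets_half sets_half] by (simp add: K_def)
qed

section \<open>Returns of conjugates of the trivial extension\<close>

lemma funpow_conjugate:
  assumes S: "S \<in> inv_mpt W" and P: "P \<in> inv_mpt W" and z: "z \<in> space W"
  shows "((the_inv_into (space W) S \<circ> P \<circ> S) ^^ n) z = the_inv_into (space W) S ((P ^^ n) (S z))"
proof (induction n)
  case 0
  show ?case using inv_mptD(7)[OF S z] by simp
next
  case (Suc n)
  have "(P ^^ n) (S z) \<in> space W"
    using inv_mptD(5)[OF inv_mpt_funpow[OF P] inv_mptD(5)[OF S z]] .
  then show ?case using Suc inv_mptD(8)[OF S] by simp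
qed

text \<open>Conjugation turns returns of \<open>E\<close> under \<open>R\<close> into returns of
  \<open>D\<close>, the image of \<open>E\<close> under \<open>S\<close>, under
  \<open>T0 \<times> id\<close>. The rigidity times serve every measurable set, so the dependence of
  \<open>D\<close> on \<open>S\<close> is harmless.\<close>

lemma rigid_conjugate_return:
  assumes T0: "T0 \<in> inv_mpt MX" and "rigid T0" and S: "S \<in> inv_mpt MZ" and E: "E \<in> sets MZ"
    and "c < measure MZ E"
  defines "R \<equiv> the_inv_into (space MZ) S \<circ> (\<lambda>(x, y). (T0 x, y)) \<circ> S"
  shows "\<exists>k\<ge>n. measure MZ ((R ^^ k) ` E \<inter> E) > c"
proof -
  let ?P = "\<lambda>(x, y). (T0 x, y)" and ?S' = "the_inv_into (space MZ) S"
  have P: "?P \<in> inv_mpt MZ" by (rule ext_setD(1)[OF ext_set_times_id[OF T0]])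
  have R: "R \<in> inv_mpt MZ"
    unfolding R_def by (intro inv_mpt_comp inv_mpt_the_inv_into S P)
  define D where "D = ?S' -` E \<inter> space MZ"
  have D: "D \<in> sets MZ" unfolding D_def using inv_mptD(4)[OF S] E by (rule measurable_sets)
  have "measure MZ D = measure MZ E"
    unfolding D_def by (rule inv_mpt_measure_vimage[OF inv_mpt_the_inv_into[OF S] E])
  moreover obtain nk :: "nat \<Rightarrow> nat" where nk: "strict_mono nk"
    "(\<lambda>k. measure MZ (D \<inter> ((?P ^^ nk k) -` D \<inter> space MZ))) \<longlonglongrightarrow> measure MZ D"
    using rigid_return_times_id[OF T0 \<open>rigid T0\<close>] D by blast
  ultimately have "eventually (\<lambda>k. measure MZ (D \<inter> ((?P ^^ nk k) -` D \<inter> space MZ)) > c) sequentially"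
    using \<open>c < measure MZ E\<close> by (intro order_tendstoD) auto
  \<comment> \<open>Choosing \<open>k \<ge> n\<close> suffices, since \<open>nk\<close> is strictly
    increasing and therefore \<open>nk k \<ge> k\<close>.\<close>
  then obtain k where k: "k \<ge> n" "measure MZ (D \<inter> ((?P ^^ nk k) -` D \<inter> space MZ)) > c"
    using eventually_happens'[OF _ eventually_conj[OF _ eventually_ge_at_top[of n]]] sequentially_bot by blast
  let ?m = "nk k"
  have "E \<inter> ((R ^^ ?m) -` E \<inter> space MZ) = S -` (D \<inter> ((?P ^^ ?m) -` D \<inter> space MZ)) \<inter> space MZ"
  proof (rule set_eqI)
    fix z
    show "z \<in> E \<inter> ((R ^^ ?m) -` E \<inter> space MZ) \<longleftrightarrow>
      z \<in> S -` (D \<inter> ((?P ^^ ?m) -` D \<inter> space MZ)) \<inter> space MZ"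
    proof (cases "z \<in> space MZ")
      case z: True
      have "S z \<in> space MZ" "(?P ^^ ?m) (S z) \<in> space MZ" "?S' (S z) = z"
        using inv_mptD(5)[OF inv_mpt_funpow[OF P]] inv_mptD(5,7)[OF S z] by blast+
      then show ?thesis
        using z funpow_conjugate[OF S P z, of ?m] by (simp add: D_def R_def)
    qed simp
  qed
  then have "measure MZ (E \<inter> ((R ^^ ?m) -` E \<inter> space MZ)) = measure MZ (D \<inter> ((?P ^^ ?m) -` D \<inter> space MZ))"
    using inv_mpt_measure_vimage[OF S, of "D \<inter> ((?P ^^ ?m) -` D \<inter> space MZ)"] D
      measurable_sets[OF inv_mptD(2)[OF inv_mpt_funpow[OF P]] D] by simp
  then have "measure MZ ((R ^^ ?m) ` E \<inter> E) > c"
    using inv_mpt_measure_image_Int[OF inv_mpt_funpow[OF R] E E] k(2) by simp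
  moreover have "?m \<ge> n" using strict_mono_imp_increasing[OF nk(1), of k] k(1) by simp
  ultimately show ?thesis by blast
qed

section \<open>The category argument\<close>

lemma topspace_ext_top: "topspace (ext_top T0) = ext_set T0"
  using ext_setD(1) by (auto simp: ext_top_def topspace_weak_top)

theorem theorem3p4:
  assumes "T0 \<in> inv_mpt MX" and "antiperiodic T0" and "rigid T0"
  shows "first_category_in (ext_top T0) (mixing_ext_set T0)"
proof -
  \<comment> \<open>The threshold 3/8 lies strictly between the mixing value 1/4 and the rigid value
    1/2.\<close>
  define G where "G k = {T \<in> ext_set T0. measure MZ ((T ^^ k) ` half \<inter> half) > 3/8}" for k
  define A where "A n = ext_set T0 - (\<Union>k\<in>{n..}. G k)" for n
  have "nowhere_dense_in (ext_top T0) (A n)" for n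
  proof -
    have "openin (ext_top T0) (G k)" for k
    proof -
      have "G k = {T \<in> inv_mpt MZ. measure MZ ((T ^^ k) ` half \<inter> half) > 3/8} \<inter> ext_set T0"
        using ext_setD(1) by (auto simp: G_def)
      then show ?thesis
        unfolding ext_top_def openin_subtopology
        using openin_weak_top_return[OF Z.finite_measure_axioms sets_half sets_half] by blast
    qed
    then have "closedin (ext_top T0) (A n)"
      unfolding A_def topspace_ext_top[symmetric] by (intro closedin_diff closedin_topspace openin_Union) auto
    then have closure: "ext_top T0 closure_of A n = A n" by (simp add: closure_of_eq)
    \<comment> \<open>Around an interior point \<open>T\<close>, all extensions uniformly close to
      \<open>T\<close> would lie in \<open>A n\<close>. One of them is a conjugate of
      \<open>T0 \<times> id\<close>, which exceeds the threshold at some time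
      \<open>k \<ge> n\<close>.\<close>
    have "ext_top T0 interior_of A n = {}"
    proof (rule ccontr)
      assume "ext_top T0 interior_of A n \<noteq> {}"
      then obtain T V where V: "openin (ext_top T0) V" "T \<in> V" "V \<subseteq> A n"
        by (auto simp: interior_of_def)
      then obtain U where U: "openin (weak_top MZ) U" "V = U \<inter> ext_set T0"
        by (auto simp: ext_top_def openin_subtopology)
      have T: "T \<in> U" "T \<in> ext_set T0" using V U by auto
      obtain e where e: "e > 0" "\<And>S. S \<in> inv_mpt MZ \<Longrightarrow>
          (\<forall>E\<in>sets MZ. measure MZ (sym_diff (S ` E) (T ` E)) < e) \<Longrightarrow> S \<in> U"
        using weak_top_uniform_nbhd[OF Z.finite_measure_axioms U(1) T(1)] by blast
      let ?R = "\<lambda>S. the_inv_into (space MZ) S \<circ> (\<lambda>(x, y). (T0 x, y)) \<circ> S"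
      obtain S where S: "S \<in> ext_set id" and R: "?R S \<in> ext_set T0"
        and near: "\<forall>E\<in>sets MZ. measure MZ (sym_diff (?R S ` E) (T ` E)) < e"
        using ext_set_conjugate_near[OF assms(1,2) T(2) e(1)] by blast
      have "?R S \<in> A n" using e(2)[OF ext_setD(1)[OF R] near] R U(2) V(3) by blast
      moreover obtain k where "k \<ge> n" "measure MZ ((?R S ^^ k) ` half \<inter> half) > 3/8"
        using rigid_conjugate_return[OF assms(1,3) ext_setD(1)[OF S] sets_half, of "3/8" n]
          measure_half by auto
      ultimately show False using R by (auto simp: A_def G_def)
    qed
    then show ?thesis by (simp add: nowhere_dense_in_def closure)
  qed
  moreover have "T \<in> (\<Union>n. A n)" if T: "T \<in> mixing_ext_set T0" for T
  proof -
    have mix: "strongly_mixing_ext T0 T" using T by (simp add: mixing_ext_set_def)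
    have "eventually (\<lambda>k. measure MZ ((T ^^ k) ` half \<inter> half) < 3/8) sequentially"
      by (rule order_tendstoD(2)[OF strongly_mixing_return[OF assms(1) mix]]) simp
    then obtain n where "\<forall>k\<ge>n. measure MZ ((T ^^ k) ` half \<inter> half) < 3/8"
      by (auto simp: eventually_sequentially)
    then have "T \<in> A n" using mix by (fastforce simp: A_def G_def strongly_mixing_ext_def)
    then show ?thesis by blast
  qed
  moreover have "mixing_ext_set T0 \<subseteq> topspace (ext_top T0)"
    by (auto simp: topspace_ext_top mixing_ext_set_def strongly_mixing_ext_def)
  ultimately show ?thesis unfolding first_category_in_def by blast
qed

end
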